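(* Let $m$ be a positive integer, let $X$ be a topological space, and let $\mathcal{C}(X)$ carry the compact-open topology. (a) If $X$ is homeomorphic to $I^m$ or to $\mathbb{R}^m$, then every open neighborhood in $\mathcal{C}(X)$ of every $h\in\mathcal{C}(X)$ contains a map $f\in\mathcal{C}(X)$ having no (even discontinuous) iterative square root, i.e. such that there is no map $g:X\to X$, continuous or not, with $g\circ g=f$. In particular, $\mathcal{W}(2;X)$ contains no non-empty open subset of $\mathcal{C}(X)$. (b) If $\phi: I^m\to X$ is a homeomorphism and $h\in\mathcal{C}(X)$ satisfies $h(x_0)=x_0$ for some $x_0\in\phi(\partial I^m)$, then every open neighborhood of $h$ in $\mathcal{C}(X)$ contains a map of the form $g\circ g$ with $g\in\mathcal{C}(X)$; that is, $h$ lies in the closure of $\mathcal{W}(2;X)$.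
   Context: $I^m=[0,1]^m\subset\mathbb{R}^m$, and $\partial I^m$ is its boundary in $\mathbb{R}^m$. $\mathcal{C}(X)$ is the set of all continuous self-maps of $X$, and $\mathcal{W}(2;X)=\{g\circ g: g\in\mathcal{C}(X)\}$. *)

theory Defs
  imports "HOL-Analysis.Analysis"
begin

definition unit_cube :: "(real ^ 'n) set"
  where "unit_cube = {x. \<forall>i. 0 \<le> x $ i \<and> x $ i \<le> 1}"

(* Self-maps of the space X are functions that are "undefined" off "topspace X" (as in
   HOL-Library.FuncSet), so that equality in HOL is equality of maps on X; accordingly
   composition on X is "compose (topspace X)". *)
definition self_maps :: "'a topology \<Rightarrow> ('a \<Rightarrow> 'a) set"
  where "self_maps X = {f \<in> extensional (topspace X). continuous_map X X f}"

definition compact_open_topology :: "'a topology \<Rightarrow> ('a \<Rightarrow> 'a) topology"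
  where "compact_open_topology X =
    topology_generated_by
      {{f \<in> self_maps X. f ` K \<subseteq> V} | K V. compactin X K \<and> openin X V}"

definition iterated_squares :: "'a topology \<Rightarrow> ('a \<Rightarrow> 'a) set"
  where "iterated_squares X = {compose (topspace X) g g | g. g \<in> self_maps X}"

(* The root g is an arbitrary map of the underlying set; continuity is not required. *)
definition has_iterative_square_root :: "'a topology \<Rightarrow> ('a \<Rightarrow> 'a) \<Rightarrow> bool"
  where "has_iterative_square_root X f \<longleftrightarrow>
    (\<exists>g \<in> topspace X \<rightarrow> topspace X. \<forall>x \<in> topspace X. g (g x) = f x)"

lemma topspace_compact_open_topology [simp]:
  "topspace (compact_open_topology X) = self_maps X"
proof -
  have "self_maps X \<in> {{f \<in> self_maps X. f ` K \<subseteq> V} | K V. compactin X K \<and> openin X V}"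
    by (rule CollectI, rule exI[of _ "{}"], rule exI[of _ "{}"]) auto
  then show ?thesis
    unfolding compact_open_topology_def topology_generated_by_topspace by blast
qed

lemma iterated_squares_subset: "iterated_squares X \<subseteq> self_maps X"
proof
  fix f assume "f \<in> iterated_squares X"
  then obtain g where f: "f = compose (topspace X) g g" and g: "continuous_map X X g"
    by (auto simp: iterated_squares_def self_maps_def)
  have "continuous_map X X f"
    by (rule continuous_map_eq[OF continuous_map_compose[OF g g]])
       (simp add: f compose_def)
  then show "f \<in> self_maps X"
    by (simp add: self_maps_def f)
qed

end

theory Submission
  imports Defs
begin

text \<open>For (a), perturb a polynomial approximation of \<open>h\<close> by \<open>\<epsilon> (x\<^sub>1\<^sup>N, \<dots>, x\<^sub>n\<^sup>N)\<close> with \<open>N\<close> large: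
  the resulting \<open>F\<close> has finite fibres and finitely many fixed points. Precomposing \<open>F\<close> with a map that
  collapses a small ball about a suitable point \<open>p\<close> of the image of \<open>F\<close> to \<open>p\<close> creates exactly one
  infinite fibre, and infinitely many points of that fibre are themselves values of the map. No map
  with this property has a square root, unless the orbit of \<open>F p\<close> becomes stationary at once.

  For (b), transport the cube to the unit ball, where the fixed point \<open>a\<close> lies on the sphere and has
  small cap neighbourhoods with convex complement. Shrinking makes the image of \<open>h\<close> avoid such a cap.
  The root \<open>g\<close> first squeezes the complement of the cap into the cap, then unfolds it by \<open>h\<close>;
  on the cap itself \<open>h\<close> is nearly constant, and only closeness to \<open>a\<close> has to be ensured.\<close>

section \<open>A criterion excluding square roots\<close>

text \<open>A root \<open>g\<close> commutes with \<open>f\<close>, so the points of the image lying over \<open>a\<close> inject into the set of points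
  \<open>z\<close> with \<open>f (f z) = g a\<close>. This makes the latter infinite, which forces \<open>f a = g a\<close>,
  and then \<open>f a\<close> is a fixed point.\<close>

lemma no_root_if_unique_infinite_fibre:
  assumes fS: "f \<in> S \<rightarrow> S" and a: "a \<in> S"
    and fin: "\<And>y. y \<in> S \<Longrightarrow> y \<noteq> a \<Longrightarrow> finite {x \<in> S. f x = y}"
    and inf: "infinite {y \<in> f ` S. f y = a}"
    and nfix: "f (f a) \<noteq> f a"
    and gS: "g \<in> S \<rightarrow> S" and root: "\<forall>x\<in>S. g (g x) = f x"
  shows False
proof -
  have comm: "f (g x) = g (f x)" if "x \<in> S" for x
    using root that gS by (metis PiE)
  have ga: "g a \<in> S" using gS a by auto
  have "g a \<noteq> a"
    using root a nfix by auto
  have "{y \<in> f ` S. f y = a} \<subseteq> g ` {z \<in> S. f (f z) = g a}"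
  proof clarify
    fix x assume x: "x \<in> S" and a: "a = f (f x)"
    have "g x \<in> S" using gS x by auto
    moreover have "f (f (g x)) = g (f (f x))"
      using comm x fS by (metis PiE)
    moreover have "f x = g (g x)" using root x by auto
    ultimately show "f x \<in> g ` {z \<in> S. f (f z) = g (f (f x))}" by blast
  qed
  then have "infinite {z \<in> S. f (f z) = g a}"
    using inf finite_surj by blast
  moreover have "{z \<in> S. f (f z) = g a} = (\<Union>w\<in>{w\<in>S. f w = g a}. {z\<in>S. f z = w})"
    using fS by auto
  ultimately obtain w where "w \<in> S" "f w = g a" "infinite {z\<in>S. f z = w}"
    using fin[OF ga \<open>g a \<noteq> a\<close>] by auto
  then have fa: "f a = g a" using fin by auto
  then have "f (f a) = g (f a)" using comm[OF a] by simp
  also have "\<dots> = f a" using fa root a by simp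
  finally show False using nfix by simp
qed

section \<open>Polynomial maps with finite fibres\<close>

text \<open>A homogeneous linear system with fewer equations than unknowns has a nontrivial
  solution. The induction is Gaussian elimination: an equation \<open>b\<close> with a nonzero
  coefficient at \<open>s\<close> serves to eliminate the unknown at \<open>s\<close>.\<close>

lemma exists_annihilating_weights:
  fixes m :: "'b \<Rightarrow> 'a \<Rightarrow> real"
  assumes "finite B" "finite T" "card B < card T"
  shows "\<exists>w. (\<exists>t\<in>T. w t \<noteq> 0) \<and> (\<forall>b\<in>B. (\<Sum>t\<in>T. w t * m b t) = 0)"
  using assms
proof (induction B arbitrary: T m rule: finite_induct)
  case empty
  then have "T \<noteq> {}" by auto
  then show ?case by (intro exI[of _ "\<lambda>_. 1"]) auto
next
  case (insert b B)
  show ?case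
  proof (cases "\<forall>t\<in>T. m b t = 0")
    case True
    have "card B < card T" using insert by simp
    then obtain w where "\<exists>t\<in>T. w t \<noteq> 0" "\<forall>b\<in>B. (\<Sum>t\<in>T. w t * m b t) = 0"
      using insert.IH[OF insert.prems(1)] by blast
    then show ?thesis using True by (intro exI[of _ w]) auto
  next
    case False
    then obtain s where s: "s \<in> T" "m b s \<noteq> 0" by auto
    define T' where "T' = T - {s}"
    have T: "T = insert s T'" "s \<notin> T'" "finite T'" 
      using s insert.prems by (auto simp: T'_def)
    have "card B < card T'" using insert T by simp
    then obtain w where w0: "\<exists>t\<in>T'. w t \<noteq> 0"
      and w: "\<forall>b'\<in>B. (\<Sum>t\<in>T'. w t * (m b' t - m b' s * m b t / m b s)) = 0"
      using insert.IH[OF \<open>finite T'\<close>, of "\<lambda>b' t. m b' t - m b' s * m b t / m b s"] by blast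
    \<comment> \<open>Back-substitution: the value at \<open>s\<close> is the one that equation
      \<open>b\<close> forces.\<close>
    define v where "v = (\<lambda>t. if t = s then - (\<Sum>t\<in>T'. w t * m b t) / m b s else w t)"
    have v: "(\<Sum>t\<in>T. v t * m b' t) = (\<Sum>t\<in>T'. w t * m b' t) - (\<Sum>t\<in>T'. w t * m b t) / m b s * m b' s" for b'
    proof -
      have "(\<Sum>t\<in>T'. v t * m b' t) = (\<Sum>t\<in>T'. w t * m b' t)"
        using T by (intro sum.cong) (auto simp: v_def)
      then show ?thesis using T by (simp add: v_def)
    qed
    have "(\<Sum>t\<in>T. v t * m b t) = 0"
      using s by (simp add: v)
    moreover have "(\<Sum>t\<in>T. v t * m b' t) = 0" if "b' \<in> B" for b'
    proof -
      have "(\<Sum>t\<in>T'. w t * (m b' t - m b' s * m b t / m b s)) = 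
        (\<Sum>t\<in>T'. w t * m b' t) - (\<Sum>t\<in>T'. w t * m b t) / m b s * m b' s"
        by (simp add: sum_subtractf sum_distrib_left sum_divide_distrib sum_distrib_right algebra_simps)
      then show ?thesis using w that by (simp add: v)
    qed
    moreover have "\<exists>t\<in>T. v t \<noteq> 0" using w0 T by (auto simp: v_def)
    ultimately show ?thesis by (intro exI[of _ v]) auto
  qed
qed

definition monomial :: "('n::finite \<Rightarrow> nat) \<Rightarrow> real ^ 'n \<Rightarrow> real"
  where "monomial \<alpha> x = (\<Prod>i\<in>UNIV. x $ i ^ \<alpha> i)"

lemma monomial_add: "monomial (\<lambda>i. \<alpha> i + \<beta> i) x = monomial \<alpha> x * monomial \<beta> x"
  by (simp add: monomial_def power_add prod.distrib)

lemma monomial_single: "monomial (\<lambda>i. if i = j then k else 0) x = x $ j ^ k"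
proof -
  have "monomial (\<lambda>i. if i = j then k else 0) x = (\<Prod>i\<in>UNIV. if i = j then x $ j ^ k else 1)"
    unfolding monomial_def by (intro prod.cong) auto
  then show ?thesis by simp
qed

text \<open>Only an upper bound on the total degree is recorded, so sums keep the bound whether or
  not leading terms cancel.\<close>

inductive poly_degree_le :: "nat \<Rightarrow> (real ^ 'n::finite \<Rightarrow> real) \<Rightarrow> bool" for k where
  monomial: "sum \<alpha> UNIV \<le> k \<Longrightarrow> poly_degree_le k (\<lambda>x. c * monomial \<alpha> x)"
| add: "poly_degree_le k p \<Longrightarrow> poly_degree_le k q \<Longrightarrow> poly_degree_le k (\<lambda>x. p x + q x)"

lemma poly_degree_le_mono: "poly_degree_le k p \<Longrightarrow> k \<le> l \<Longrightarrow> poly_degree_le l p"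
  by (induction rule: poly_degree_le.induct) (auto intro: poly_degree_le.intros)

lemma poly_degree_le_const: "poly_degree_le k (\<lambda>x. c)"
  using poly_degree_le.monomial[of "\<lambda>_. 0" k c] by (simp add: monomial_def)

lemma poly_degree_le_component: "poly_degree_le 1 (\<lambda>x. c * x $ j)"
  using poly_degree_le.monomial[of "\<lambda>i. if i = j then 1 else 0" 1 c] by (simp add: monomial_single)

lemma poly_degree_le_sum:
  "finite I \<Longrightarrow> (\<And>i. i \<in> I \<Longrightarrow> poly_degree_le k (p i)) \<Longrightarrow> poly_degree_le k (\<lambda>x. \<Sum>i\<in>I. p i x)"
  by (induction I rule: finite_induct) (auto intro: poly_degree_le.add poly_degree_le_const)

lemma poly_degree_le_mult:
  assumes "poly_degree_le k p" "poly_degree_le l q"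
  shows "poly_degree_le (k + l) (\<lambda>x. p x * q x)"
  using assms(1)
proof induction
  case (monomial \<alpha> c)
  show ?case using assms(2)
  proof induction
    case (monomial \<beta> d)
    have "poly_degree_le (k + l) (\<lambda>x. (c * d) * monomial (\<lambda>i. \<alpha> i + \<beta> i) x)"
      using monomial \<open>sum \<alpha> UNIV \<le> k\<close> by (intro poly_degree_le.monomial) (simp add: sum.distrib)
    then show ?case by (simp add: monomial_add mult_ac)
  next
    case (add p q)
    then show ?case by (auto simp: distrib_left intro: poly_degree_le.add)
  qed
next
  case (add p q)
  then show ?case by (auto simp: distrib_right intro: poly_degree_le.add)
qed

text \<open>Links the polynomials supplied by Stone-Weierstrass to explicit sums of monomials; a
  linear form is expanded in the standard basis.\<close>

lemma real_polynomial_function_degree: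
  fixes p :: "real ^ 'n::finite \<Rightarrow> real"
  assumes "real_polynomial_function p"
  shows "\<exists>k. poly_degree_le k p"
  using assms
proof induction
  case (linear f)
  interpret bounded_linear f by fact
  have "f x = (\<Sum>i\<in>UNIV. f (axis i 1) * x $ i)" for x
  proof -
    have "f x = f (\<Sum>i\<in>UNIV. x $ i *\<^sub>R axis i 1)"
      by (metis basis_expansion scalar_mult_eq_scaleR)
    then show ?thesis by (simp add: sum scaleR mult.commute)
  qed
  then have "f = (\<lambda>x. \<Sum>i\<in>UNIV. f (axis i 1) * x $ i)" by blast
  moreover have "poly_degree_le 1 (\<lambda>x. \<Sum>i\<in>UNIV. f (axis i 1) * x $ i)"
    by (intro poly_degree_le_sum poly_degree_le_component) auto
  ultimately show ?case by metis
next
  case (const c)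
  then show ?case using poly_degree_le_const by blast
next
  case (add f g)
  then obtain k l where "poly_degree_le k f" "poly_degree_le l g" by blast
  then have "poly_degree_le (max k l) (\<lambda>x. f x + g x)"
    by (auto intro!: poly_degree_le.add elim: poly_degree_le_mono)
  then show ?case by blast
next
  case (mult f g)
  then show ?case using poly_degree_le_mult by blast
qed

text \<open>On the solution set every monomial reduces to a combination of monomials with all exponents
  below \<open>N\<close>. Given more solutions than there are such monomials, some nonzero linear functional
  on functions on these solutions kills all monomials, hence all polynomials; but polynomials
  separate points.\<close>
lemma finite_solutions_power_eq_lower_degree:
  fixes q :: "'n::finite \<Rightarrow> real ^ 'n \<Rightarrow> real"
  assumes q: "\<And>i. poly_degree_le k (q i)" and "k < N"
  shows "finite {x. \<forall>i. x $ i ^ N = q i x}"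
proof (rule ccontr)
  define B where "B = {\<alpha> :: 'n \<Rightarrow> nat. \<forall>i. \<alpha> i < N}"
  have "B = (\<Pi>\<^sub>E i\<in>UNIV. {..<N})" by (auto simp: B_def)
  then have "finite B" by (auto intro!: finite_PiE)
  assume "infinite {x. \<forall>i. x $ i ^ N = q i x}"
  then obtain T where T: "finite T" "card T = Suc (card B)" "T \<subseteq> {x. \<forall>i. x $ i ^ N = q i x}"
    using infinite_arbitrarily_large by blast
  obtain w t where t: "t \<in> T" "w t \<noteq> 0"
    and w: "\<And>\<alpha>. \<alpha> \<in> B \<Longrightarrow> (\<Sum>t\<in>T. w t * monomial \<alpha> t) = 0"
    using exists_annihilating_weights[OF \<open>finite B\<close> \<open>finite T\<close>, of monomial] T(2) by auto
  \<comment> \<open>The degree bound in the second premise lets this serve inside the induction of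
    \<open>mono0\<close>, where only monomials of smaller degree are known to be killed.\<close>
  have poly0: "(\<Sum>t\<in>T. w t * (p t * monomial \<beta> t)) = 0"
    if "poly_degree_le l p" and "\<And>\<alpha>. sum \<alpha> UNIV \<le> l + sum \<beta> UNIV \<Longrightarrow> (\<Sum>t\<in>T. w t * monomial \<alpha> t) = 0"
    for l p \<beta>
    using that
  proof induction
    case (monomial \<alpha> c)
    have "(\<Sum>t\<in>T. w t * (c * monomial \<alpha> t * monomial \<beta> t)) = c * (\<Sum>t\<in>T. w t * monomial (\<lambda>i. \<alpha> i + \<beta> i) t)"
      by (simp add: monomial_add sum_distrib_left mult_ac)
    then show ?case using monomial by (simp add: sum.distrib)
  next
    case (add p q)
    then show ?case by (simp add: distrib_left distrib_right sum.distrib)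
  qed
  have mono0: "(\<Sum>t\<in>T. w t * monomial \<alpha> t) = 0" for \<alpha>
  proof (induction "sum \<alpha> UNIV" arbitrary: \<alpha> rule: less_induct)
    case less
    show ?case
    proof (cases "\<alpha> \<in> B")
      case True
      then show ?thesis by (rule w)
    next
      case False
      then obtain j where j: "N \<le> \<alpha> j" by (auto simp: B_def not_less)
      \<comment> \<open>Split off the \<open>N\<close>-th power of coordinate \<open>j\<close>. On
        \<open>T\<close> it equals \<open>q j\<close>, of degree at most \<open>k < N\<close>, so
        the total degree drops.\<close>
      define \<beta> where "\<beta> = (\<lambda>i. if i = j then \<alpha> i - N else \<alpha> i)"
      have \<alpha>: "\<alpha> = (\<lambda>i. (if i = j then N else 0) + \<beta> i)"
        using j by (auto simp: \<beta>_def)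
      have "sum \<alpha> UNIV = N + sum \<beta> UNIV"
        by (subst \<alpha>) (simp add: sum.distrib)
      then have "(\<Sum>t\<in>T. w t * (q j t * monomial \<beta> t)) = 0"
        using \<open>k < N\<close> by (intro poly0[OF q]) (auto intro!: less)
      moreover have "monomial \<alpha> t = q j t * monomial \<beta> t" if "t \<in> T" for t
        using T(3) that by (subst \<alpha>) (auto simp: monomial_add monomial_single)
      ultimately show ?thesis by simp
    qed
  qed
  \<comment> \<open>A polynomial vanishing on \<open>T\<close> except at \<open>t\<close>; the
    functional reduces on it to \<open>w t * p t\<close>.\<close>
  define p where "p = (\<lambda>x. \<Prod>s\<in>T - {t}. (x - s) \<bullet> (t - s))"
  have "real_polynomial_function (\<lambda>x. (x - s) \<bullet> (t - s))" for s
  proof -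
    have "real_polynomial_function (\<lambda>x. x \<bullet> (t - s) + - (s \<bullet> (t - s)))"
      by (intro real_polynomial_function.intros bounded_linear_inner_left)
    then show ?thesis by (simp add: inner_diff_left)
  qed
  then have "real_polynomial_function p"
    unfolding p_def using T(1) by (intro real_polynomial_function_prod) auto
  then obtain l where "poly_degree_le l p"
    using real_polynomial_function_degree by blast
  from poly0[OF this mono0, of "\<lambda>_. 0"] have "(\<Sum>x\<in>T. w x * p x) = 0"
    by (simp add: monomial_def)
  moreover have "(\<Sum>x\<in>T. w x * p x) = (\<Sum>x\<in>T. if x = t then w t * p t else 0)"
  proof (intro sum.cong refl)
    fix x assume "x \<in> T"
    then have "p x = 0" if "x \<noteq> t"
      unfolding p_def using T(1) that by (intro prod_zero bexI[of _ x]) auto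
    then show "w x * p x = (if x = t then w t * p t else 0)" by simp
  qed
  ultimately have "w t * p t = 0" using t T(1) by simp
  moreover have "p t \<noteq> 0" using T(1) by (auto simp: p_def)
  ultimately show False using t by simp
qed

text \<open>After division by \<open>r\<close>, both \<open>F x = y\<close> and
  \<open>F x = x\<close> express each \<open>x $ i ^ N\<close> by a polynomial of degree below
  \<open>N\<close>. The error \<open>e\<close> is shared equally between Stone-Weierstrass and the
  perturbation \<open>r *\<^sub>R Q x\<close>.\<close>

lemma approximation_with_finite_fibres:
  fixes H :: "real ^ 'n \<Rightarrow> real ^ 'n"
  assumes K: "compact K" and H: "continuous_on K H" and "e > 0"
  obtains F where "continuous_on UNIV F" "\<And>x. x \<in> K \<Longrightarrow> norm (F x - H x) < e"
    "\<And>y. finite {x. F x = y}" "finite {x. F x = x}"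
proof -
  obtain P where P: "polynomial_function P" and PH: "\<And>x. x \<in> K \<Longrightarrow> norm (H x - P x) < e / 2"
    using Stone_Weierstrass_polynomial_function[OF K H, of "e / 2"] \<open>e > 0\<close> by auto
  have "real_polynomial_function (\<lambda>x. P x $ i)" for i
    using P bounded_linear_vec_nth[of i] by (auto simp: polynomial_function_def o_def)
  then have "\<forall>i. \<exists>k. poly_degree_le k (\<lambda>x. P x $ i)"
    using real_polynomial_function_degree by blast
  from choice[OF this] obtain d where d: "\<And>i. poly_degree_le (d i) (\<lambda>x. P x $ i)"
    by blast
  \<comment> \<open>The \<open>Suc\<close> makes \<open>k\<close> at least 1, which covers the
    linear term of the fixed point equation.\<close>
  define k where "k = Suc (Max (range d))"
  have dk: "d i \<le> k" for i
    unfolding k_def by (intro le_SucI Max_ge) auto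
  define N where "N = Suc k"
  define Q :: "real ^ 'n \<Rightarrow> real ^ 'n" where "Q = (\<lambda>x. \<chi> i. x $ i ^ N)"
  have contQ: "continuous_on A Q" for A
    unfolding Q_def by (intro continuous_intros)
  then have "bounded (Q ` K)"
    using K by (intro compact_imp_bounded compact_continuous_image)
  then obtain M where M: "M > 0" "\<And>x. x \<in> K \<Longrightarrow> norm (Q x) \<le> M"
    by (auto simp: bounded_pos)
  define r where "r = e / (2 * M)"
  have "r > 0" using M \<open>e > 0\<close> by (simp add: r_def)
  define F where "F = (\<lambda>x. P x + r *\<^sub>R Q x)"
  have Peq: "poly_degree_le k (\<lambda>x. - 1 / r * P x $ i)" for i
    using poly_degree_le_mult[OF poly_degree_le_const[of 0 "- 1 / r"] poly_degree_le_mono[OF d dk]] by simp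
  show thesis
  proof
    show "continuous_on UNIV F"
      unfolding F_def using P by (intro continuous_intros contQ continuous_on_polymonial_function)
    show "norm (F x - H x) < e" if "x \<in> K" for x
    proof -
      have "norm (r *\<^sub>R Q x) \<le> r * M" using M that \<open>r > 0\<close> by simp
      also have "\<dots> = e / 2" using M by (simp add: r_def)
      finally have "norm (r *\<^sub>R Q x - (H x - P x)) < e"
        using PH[OF that] norm_triangle_ineq4[of "r *\<^sub>R Q x" "H x - P x"] by linarith
      then show ?thesis by (simp add: F_def algebra_simps)
    qed
    show "finite {x. F x = y}" for y
    proof (rule finite_subset)
      show "{x. F x = y} \<subseteq> {x. \<forall>i. x $ i ^ N = y $ i / r + - 1 / r * P x $ i}"
        using \<open>r > 0\<close> by (auto simp: F_def Q_def field_simps)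
      show "finite {x. \<forall>i. x $ i ^ N = y $ i / r + - 1 / r * P x $ i}"
        by (rule finite_solutions_power_eq_lower_degree[of k])
           (intro poly_degree_le.add poly_degree_le_const Peq, simp add: N_def)
    qed
    show "finite {x. F x = x}"
    proof (rule finite_subset)
      show "{x. F x = x} \<subseteq> {x. \<forall>i. x $ i ^ N = 1 / r * x $ i + - 1 / r * P x $ i}"
      proof clarify
        fix x i assume "F x = x"
        then have "(P x + r *\<^sub>R Q x) $ i = x $ i"
          by (simp only: F_def)
        then have "P x $ i + r * x $ i ^ N = x $ i"
          by (simp add: Q_def)
        then show "x $ i ^ N = 1 / r * x $ i + - 1 / r * P x $ i"
          using \<open>r > 0\<close> by (simp add: field_simps)
      qed
      show "finite {x. \<forall>i. x $ i ^ N = 1 / r * x $ i + - 1 / r * P x $ i}"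
        by (rule finite_solutions_power_eq_lower_degree[of k])
           (intro poly_degree_le.add Peq poly_degree_le_mono[OF poly_degree_le_component],
            simp_all add: N_def k_def)
    qed
  qed
qed

section \<open>Collapsing a ball\<close>

text \<open>A radial map sending \<open>cball p r\<close> to \<open>p\<close>, injective off that ball and the identity outside
  \<open>ball p (2 * r)\<close>.\<close>

definition collapse :: "'a::real_normed_vector \<Rightarrow> real \<Rightarrow> 'a \<Rightarrow> 'a"
  where "collapse p r x = p + max 0 (min 1 (norm (x - p) / r - 1)) *\<^sub>R (x - p)"

lemma continuous_on_collapse: "r > 0 \<Longrightarrow> continuous_on A (collapse p r)"
  unfolding collapse_def by (intro continuous_intros) auto

lemma collapse_in_convex: "convex S \<Longrightarrow> p \<in> S \<Longrightarrow> x \<in> S \<Longrightarrow> collapse p r x \<in> S"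
proof -
  assume S: "convex S" "p \<in> S" "x \<in> S"
  define a where "a = max 0 (min 1 (norm (x - p) / r - 1))"
  have "collapse p r x = (1 - a) *\<^sub>R p + a *\<^sub>R x"
    by (simp add: collapse_def a_def algebra_simps)
  also have "\<dots> \<in> S"
    using S by (intro convexD) (auto simp: a_def)
  finally show ?thesis .
qed

lemma collapse_eq_centre: "r > 0 \<Longrightarrow> norm (x - p) \<le> r \<Longrightarrow> collapse p r x = p"
  by (simp add: collapse_def max_def min_def field_simps)

lemma collapse_eq_self: "r > 0 \<Longrightarrow> x = p \<or> norm (x - p) \<ge> 2 * r \<Longrightarrow> collapse p r x = x"
  by (auto simp: collapse_def max_def min_def field_simps)

lemma norm_collapse_diff_le:
  assumes "r > 0"
  shows "norm (collapse p r x - x) \<le> 2 * r"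
proof (cases "norm (x - p) \<ge> 2 * r")
  case True
  then show ?thesis using assms by (simp add: collapse_eq_self)
next
  case False
  define a where "a = max 0 (min 1 (norm (x - p) / r - 1))"
  have a: "0 \<le> a" "a \<le> 1" by (auto simp: a_def)
  have "collapse p r x - x = (a - 1) *\<^sub>R (x - p)"
    by (simp add: collapse_def a_def algebra_simps)
  then have "norm (collapse p r x - x) \<le> norm (x - p)"
    using a by (simp add: mult_left_le_one_le)
  then show ?thesis using False by simp
qed

text \<open>The distance to \<open>p\<close> is changed from \<open>t\<close> to
  \<open>\<phi> t * t\<close>, which is strictly increasing where \<open>\<phi>\<close> is positive.
  Equal images other than \<open>p\<close> thus come from equal distances, and the common factor
  cancels.\<close>

lemma collapse_inj:
  assumes r: "r > 0" and eq: "collapse p r x = collapse p r y" and np: "collapse p r x \<noteq> p"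
  shows "x = y"
proof -
  define \<phi> where "\<phi> = (\<lambda>t. max 0 (min 1 (t / r - 1)))"
  have c: "collapse p r z = p + \<phi> (norm (z - p)) *\<^sub>R (z - p)" for z
    by (simp add: collapse_def \<phi>_def)
  have \<phi>_mono: "\<phi> s \<le> \<phi> t" if "s \<le> t" for s t
    unfolding \<phi>_def
    by (intro max.mono min.mono diff_right_mono divide_right_mono that order_refl) (use r in simp)
  have \<phi>0: "\<phi> t \<ge> 0" for t by (simp add: \<phi>_def)
  define s where "s = norm (x - p)"
  define t where "t = norm (y - p)"
  have veq: "\<phi> s *\<^sub>R (x - p) = \<phi> t *\<^sub>R (y - p)"
    using eq by (simp add: c s_def t_def)
  have "\<phi> s \<noteq> 0" "\<phi> t \<noteq> 0"
    using np eq by (auto simp: c s_def t_def)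
  then have pos: "\<phi> s > 0" "\<phi> t > 0" using \<phi>0 by (simp_all add: less_le)
  have "norm (\<phi> s *\<^sub>R (x - p)) = norm (\<phi> t *\<^sub>R (y - p))" using veq by simp
  then have neq: "\<phi> s * s = \<phi> t * t"
    using pos by (simp add: s_def t_def)
  have lt: "\<phi> u * u < \<phi> v * v" if "u < v" "\<phi> u > 0" "u \<ge> 0" for u v
    using that \<phi>_mono[of u v] by (intro mult_le_less_imp_less) auto
  have "s = t"
    using lt[of s t] lt[of t s] neq pos by (metis linorder_less_linear less_irrefl norm_ge_zero s_def t_def)
  then show ?thesis using veq pos by simp
qed

text \<open>An infinite connected set has no isolated points.\<close>

lemma infinite_inter_ball:
  fixes S :: "'a::metric_space set"
  assumes "connected S" "infinite S" "a \<in> S" "r > 0"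
  shows "infinite (S \<inter> ball a r)"
proof -
  have "a islimpt S"
    using assms by (intro connected_imp_perfect) auto
  then show ?thesis using \<open>r > 0\<close> by (simp add: islimpt_eq_infinite_ball)
qed

lemma finite_if_finite_fibres:
  assumes "finite (F ` V)" "\<And>y. y \<in> F ` V \<Longrightarrow> finite {x \<in> V. F x = y}"
  shows "finite V"
proof -
  have "V = (\<Union>y\<in>F ` V. {x \<in> V. F x = y})" by auto
  then show ?thesis using assms by (metis (no_types, lifting) finite_UN_I)
qed

lemma rootless_approximation:
  fixes S :: "'a::euclidean_space set"
  assumes S: "closed S" "convex S" "infinite S"
    and F: "continuous_on S F" "F \<in> S \<rightarrow> S"
    and fib: "\<And>y. finite {x \<in> S. F x = y}" and fixp: "finite {x \<in> S. F x = x}"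
    and K: "compact K" "K \<subseteq> S" and "e > 0"
  obtains f where "continuous_on S f" "f \<in> S \<rightarrow> S" "\<And>x. x \<in> K \<Longrightarrow> norm (f x - F x) < e"
    "\<not> (\<exists>g\<in>S \<rightarrow> S. \<forall>x\<in>S. g (g x) = f x)"
proof -
  have FS: "F x \<in> S" if "x \<in> S" for x using F that by auto
  have conn: "connected S" using S convex_connected by blast
  have fin_pre: "finite {x \<in> S. F x \<in> A}" if "finite A" for A
  proof -
    have "{x \<in> S. F x \<in> A} = (\<Union>y\<in>A. {x \<in> S. F x = y})" by auto
    then show ?thesis using that fib by auto
  qed
  \<comment> \<open>These are the points whose third iterate is fixed. Choosing \<open>u\<close>
    outside them gives at once \<open>u \<noteq> p\<close>, \<open>x0 \<noteq> p\<close> and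
    \<open>F (F x0) \<noteq> F x0\<close>.\<close>
  have "finite {x \<in> S. F x \<in> {x \<in> S. F x \<in> {x \<in> S. F x \<in> {x \<in> S. F x = x}}}}"
    (is "finite ?A")
    by (intro fin_pre fixp)
  then have "\<not> S \<subseteq> ?A" using S(3) finite_subset by blast
  then obtain u where u: "u \<in> S" "F (F (F (F u))) \<noteq> F (F (F u))"
    using FS by auto
  define p where "p = F u"
  define x0 where "x0 = F p"
  have pS: "p \<in> S" and x0S: "x0 \<in> S" using u FS by (auto simp: p_def x0_def)
  have "u \<noteq> p" "x0 \<noteq> p" and Fx0: "F (F x0) \<noteq> F x0"
    using u(2) by (auto simp: p_def x0_def)
  \<comment> \<open>The collapse need not preserve \<open>K\<close>, but it maps \<open>K\<close>
    into a ball containing \<open>K\<close> and \<open>p\<close>, by convexity. Uniform continuity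
    is therefore taken on that larger set.\<close>
  obtain B where B: "\<And>x. x \<in> insert p K \<Longrightarrow> norm x \<le> B"
    using compact_imp_bounded[of "insert p K"] K(1) by (auto simp: bounded_iff compact_insert)
  have "compact (S \<inter> cball 0 B)"
    using S(1) by (simp add: closed_Int_compact)
  then have "uniformly_continuous_on (S \<inter> cball 0 B) F"
    using F(1) by (intro compact_uniformly_continuous continuous_on_subset[OF F(1)]) auto
  then obtain \<delta> where "\<delta> > 0" and \<delta>: "\<And>x y. x \<in> S \<inter> cball 0 B \<Longrightarrow> y \<in> S \<inter> cball 0 B \<Longrightarrow>
      dist y x < \<delta> \<Longrightarrow> dist (F y) (F x) < e"
    unfolding uniformly_continuous_on_def using \<open>e > 0\<close> by metis
  \<comment> \<open>If \<open>F x0 = p\<close>, the collapse fixes \<open>F x0\<close> anyway, and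
    the value 1 keeps the minimum below positive.\<close>
  define d where "d = (if F x0 = p then 1 else norm (F x0 - p))"
  \<comment> \<open>The quarters ensure that \<open>c\<close> moves points by less than
    \<open>\<delta>\<close>, fixes \<open>x0\<close> and \<open>F x0\<close>, and fixes every point
    within \<open>r\<close> of \<open>u\<close>.\<close>
  define r where "r = Min {\<delta> / 4, norm (u - p) / 4, norm (x0 - p) / 4, d / 4}"
  have r: "r > 0" "r \<le> \<delta> / 4" "r \<le> norm (u - p) / 4" "r \<le> norm (x0 - p) / 4" "r \<le> d / 4"
    using \<open>\<delta> > 0\<close> \<open>u \<noteq> p\<close> \<open>x0 \<noteq> p\<close> by (auto simp: r_def d_def)
  define c where "c = collapse p r"
  have cS: "c x \<in> S" if "x \<in> S" for x
    using collapse_in_convex[OF S(2) pS that] by (simp add: c_def)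
  have c_x0: "c x0 = x0" and c_Fx0: "c (F x0) = F x0"
    using r by (auto simp: c_def d_def intro!: collapse_eq_self split: if_splits)
  define f where "f = (\<lambda>x. F (c x))"
  have f_ball: "f x = x0" if "x \<in> ball p r" for x
    using that r by (simp add: f_def c_def x0_def collapse_eq_centre dist_norm norm_minus_commute)
  show thesis
  proof
    show "continuous_on S f"
      unfolding f_def using r cS
      by (intro continuous_on_compose2[OF F(1)]) (auto simp: c_def continuous_on_collapse)
    show fS: "f \<in> S \<rightarrow> S" using FS cS by (auto simp: f_def)
    show "norm (f x - F x) < e" if "x \<in> K" for x
    proof -
      have "c x \<in> cball 0 B"
        unfolding c_def using B that by (intro collapse_in_convex) auto
      moreover have "dist (c x) x < \<delta>"
        using norm_collapse_diff_le[of r p x] r \<open>\<delta> > 0\<close> by (simp add: c_def dist_norm)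
      ultimately show ?thesis
        using \<delta>[of x "c x"] that K(2) cS B by (auto simp: f_def dist_norm)
    qed
    show "\<not> (\<exists>g\<in>S \<rightarrow> S. \<forall>x\<in>S. g (g x) = f x)"
    proof
      assume "\<exists>g\<in>S \<rightarrow> S. \<forall>x\<in>S. g (g x) = f x"
      then obtain g where g: "g \<in> S \<rightarrow> S" "\<forall>x\<in>S. g (g x) = f x" by blast
      show False
      proof (rule no_root_if_unique_infinite_fibre[OF fS x0S _ _ _ g])
        fix y assume y: "y \<in> S" "y \<noteq> x0"
        \<comment> \<open>On this fibre \<open>c\<close> avoids the value \<open>p\<close>, since
          \<open>F p = x0\<close>; hence \<open>c\<close> embeds it into a finite fibre of
          \<open>F\<close>.\<close>
        have "inj_on c {x \<in> S. f x = y}"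
        proof (rule inj_onI)
          fix x x' assume "x \<in> {x \<in> S. f x = y}" "c x = c x'"
          moreover from this have "c x \<noteq> p" using y by (auto simp: f_def x0_def)
          ultimately show "x = x'" using collapse_inj[OF r(1), of p x x'] by (simp add: c_def)
        qed
        moreover have "finite (c ` {x \<in> S. f x = y})"
          by (rule finite_subset[OF _ fib[of y]]) (auto simp: f_def cS)
        ultimately show "finite {x \<in> S. f x = y}" by (rule finite_imageD[rotated])
      next
        have "\<exists>\<eta>>0. \<forall>x\<in>S. dist x u < \<eta> \<longrightarrow> dist (F x) (F u) < r"
          using F(1) u(1) r(1) unfolding continuous_on_iff by blast
        then obtain \<eta> where \<eta>: "\<eta> > 0" "\<And>x. x \<in> S \<Longrightarrow> dist x u < \<eta> \<Longrightarrow> dist (F x) p < r"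
          unfolding p_def by blast
        define V where "V = S \<inter> ball u (min \<eta> r)"
        have "infinite V"
          unfolding V_def using r \<eta> u S conn by (intro infinite_inter_ball) auto
        moreover have "finite {x \<in> V. F x = y}" for y
          by (rule finite_subset[OF _ fib[of y]]) (auto simp: V_def)
        ultimately have "infinite (F ` V)" using finite_if_finite_fibres[of F V] by blast
        moreover have "F ` V \<subseteq> {y \<in> f ` S. f y = x0}"
        proof clarify
          fix x assume x: "x \<in> V"
          then have xS: "x \<in> S" and xu: "norm (u - x) < r" and xe: "dist x u < \<eta>"
            by (auto simp: V_def dist_norm norm_minus_commute)
          have "norm (x - p) \<ge> 2 * r"
            using norm_triangle_ineq[of "u - x" "x - p"] xu r by simp
          then have "f x = F x" using r by (simp add: f_def c_def collapse_eq_self)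
          moreover have "f (F x) = x0"
            using \<eta>(2)[OF xS xe] by (intro f_ball) (simp add: dist_commute)
          ultimately show "F x \<in> f ` S \<and> f (F x) = x0" using xS by (metis imageI)
        qed
        ultimately show "infinite {y \<in> f ` S. f y = x0}" using infinite_super by blast
      next
        show "f (f x0) \<noteq> f x0" using Fx0 by (simp add: f_def c_x0 c_Fx0)
      qed
    qed
  qed
qed

section \<open>The compact-open topology\<close>

text \<open>Reduces neighbourhoods in the function space to uniform closeness on a compact subset of
  a metric model. For a subbasic set the compact image of \<open>K\<close> has a positive margin
  inside an open set; intersections take the union of the compact sets and the smaller
  margin.\<close>

lemma compact_open_topology_neighbourhood:
  fixes S :: "'b::metric_space set"
  assumes hm: "homeomorphic_maps (top_of_set S) X \<phi> \<psi>"
    and U: "openin (compact_open_topology X) U" and h: "h \<in> U"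
  shows "\<exists>K e. compact K \<and> K \<subseteq> S \<and> e > 0 \<and>
    (\<forall>f. continuous_on S f \<longrightarrow> f \<in> S \<rightarrow> S \<longrightarrow> (\<forall>x\<in>K. dist (f x) (\<psi> (h (\<phi> x))) < e) \<longrightarrow>
      restrict (\<phi> \<circ> f \<circ> \<psi>) (topspace X) \<in> U)"
proof -
  have cont: "continuous_map (top_of_set S) X \<phi>" "continuous_map X (top_of_set S) \<psi>"
    and inv: "\<And>x. x \<in> topspace X \<Longrightarrow> \<phi> (\<psi> x) = x"
    using hm by (auto simp: homeomorphic_maps_def)
  have \<psi>S: "\<psi> x \<in> S" if "x \<in> topspace X" for x
    using continuous_map_image_subset_topspace[OF cont(2)] that by auto
  have "generate_topology_on {{f \<in> self_maps X. f ` K \<subseteq> V} | K V. compactin X K \<and> openin X V} U"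
    using U unfolding compact_open_topology_def openin_topology_generated_by_iff .
  then show ?thesis using h
  proof (induction rule: generate_topology_on.induct)
    case Empty
    then show ?case by simp
  next
    case (Int U V)
    then obtain K L d e where KL: "compact K" "K \<subseteq> S" "d > 0" "compact L" "L \<subseteq> S" "e > 0"
      and inU: "\<And>f. continuous_on S f \<Longrightarrow> f \<in> S \<rightarrow> S \<Longrightarrow> (\<forall>x\<in>K. dist (f x) (\<psi> (h (\<phi> x))) < d) \<Longrightarrow>
        restrict (\<phi> \<circ> f \<circ> \<psi>) (topspace X) \<in> U"
      and inV: "\<And>f. continuous_on S f \<Longrightarrow> f \<in> S \<rightarrow> S \<Longrightarrow> (\<forall>x\<in>L. dist (f x) (\<psi> (h (\<phi> x))) < e) \<Longrightarrow>
        restrict (\<phi> \<circ> f \<circ> \<psi>) (topspace X) \<in> V"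
      by (metis (no_types, lifting) IntD1 IntD2)
    have "restrict (\<phi> \<circ> f \<circ> \<psi>) (topspace X) \<in> U \<inter> V"
      if "continuous_on S f" "f \<in> S \<rightarrow> S" "\<forall>x\<in>K \<union> L. dist (f x) (\<psi> (h (\<phi> x))) < min d e" for f
      using that by (intro IntI inU inV) auto
    moreover have "compact (K \<union> L)" "K \<union> L \<subseteq> S" "min d e > 0"
      using KL by (auto simp: compact_Un)
    ultimately show ?case by blast
  next
    case (UN \<U>)
    then obtain U where "U \<in> \<U>" "h \<in> U" by blast
    with UN.IH[OF this] show ?case by (meson UnionI)
  next
    case (Basis U)
    then obtain K V where U: "U = {f \<in> self_maps X. f ` K \<subseteq> V}" and K: "compactin X K"
      and V: "openin X V" by blast
    have KX: "K \<subseteq> topspace X" using K compactin_subset_topspace by blast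
    have contH: "continuous_map X (top_of_set S) (\<psi> \<circ> h)"
      using Basis.prems by (intro continuous_map_compose[OF _ cont(2)]) (simp add: U self_maps_def)
    have "compactin (top_of_set S) (\<psi> ` K)" "compactin (top_of_set S) ((\<psi> \<circ> h) ` K)"
      using image_compactin[OF K] cont(2) contH by blast+
    then have comp: "compact (\<psi> ` K)" "\<psi> ` K \<subseteq> S" "compact ((\<psi> \<circ> h) ` K)"
      by (auto simp: compactin_subtopology)
    have "openin (top_of_set S) {x \<in> S. \<phi> x \<in> V}"
      using openin_continuous_map_preimage[OF cont(1) V] by simp
    then obtain W where W: "open W" "{x \<in> S. \<phi> x \<in> V} = S \<inter> W"
      by (auto simp: openin_open)
    have "(\<psi> \<circ> h) ` K \<subseteq> W"
    proof clarsimp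
      fix x assume "x \<in> K"
      then have "h x \<in> V" using Basis.prems U by auto
      moreover have "h x \<in> topspace X" using V \<open>h x \<in> V\<close> openin_subset by blast
      ultimately have "\<psi> (h x) \<in> {x \<in> S. \<phi> x \<in> V}" using inv \<psi>S by simp
      then show "\<psi> (h x) \<in> W" unfolding W(2) by blast
    qed
    then obtain e where e: "e > 0" "(\<Union>x\<in>(\<psi> \<circ> h) ` K. ball x e) \<subseteq> W"
      using compact_subset_open_imp_ball_epsilon_subset[OF comp(3) W(1)] by metis
    have "restrict (\<phi> \<circ> f \<circ> \<psi>) (topspace X) \<in> U"
      if f: "continuous_on S f" "f \<in> S \<rightarrow> S"
        and near: "\<forall>x\<in>\<psi> ` K. dist (f x) (\<psi> (h (\<phi> x))) < e" for f
    proof -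
      have fmap: "continuous_map (top_of_set S) (top_of_set S) f" using f by simp
      have "continuous_map X X (\<phi> \<circ> f \<circ> \<psi>)"
        by (rule continuous_map_compose[OF cont(2) continuous_map_compose[OF fmap cont(1)]])
      then have "restrict (\<phi> \<circ> f \<circ> \<psi>) (topspace X) \<in> self_maps X"
        by (auto simp: self_maps_def intro: continuous_map_eq)
      moreover have "(\<phi> \<circ> f \<circ> \<psi>) x \<in> V" if "x \<in> K" for x
      proof -
        have x: "x \<in> topspace X" using that KX by blast
        have "dist (\<psi> (h x)) (f (\<psi> x)) < e"
          using near that inv[OF x] by (auto simp: dist_commute)
        then have "f (\<psi> x) \<in> ball ((\<psi> \<circ> h) x) e" by simp
        then have "f (\<psi> x) \<in> W" using e(2) that by blast
        then show ?thesis using W(2) f(2) \<psi>S[OF x] by auto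
      qed
      ultimately show ?thesis using KX by (auto simp: U)
    qed
    then show ?case using comp e(1) by blast
  qed
qed

section \<open>Approximation within the cube and proof of (a)\<close>

lemma unit_cube_eq_cbox: "unit_cube = cbox (0 :: real ^ 'n) 1"
  by (auto simp: unit_cube_def mem_box_cart)

lemma infinite_unit_cube: "infinite (unit_cube :: (real ^ 'n) set)"
proof
  assume "finite (unit_cube :: (real ^ 'n) set)"
  moreover have "connected (unit_cube :: (real ^ 'n) set)"
    by (simp add: unit_cube_eq_cbox convex_connected)
  moreover have "(0 :: real ^ 'n) \<in> unit_cube" "(1 :: real ^ 'n) \<in> unit_cube"
    by (simp_all add: unit_cube_def)
  ultimately show False
    using connected_finite_iff_sing by (metis empty_iff singletonD zero_neq_one)
qed

text \<open>A polynomial perturbation may leave the cube. Contracting \<open>H\<close> towards the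
  centre \<open>m\<close> first keeps its values at least \<open>t / 2\<close> away from every face,
  which leaves room for an error below \<open>t / 2\<close>.\<close>

lemma finite_fibre_approximation_unit_cube:
  fixes H :: "real ^ 'n \<Rightarrow> real ^ 'n"
  assumes H: "continuous_on unit_cube H" "H \<in> unit_cube \<rightarrow> unit_cube" and "e > 0"
  obtains F where "continuous_on UNIV F" "F \<in> unit_cube \<rightarrow> unit_cube"
    "\<And>x. x \<in> unit_cube \<Longrightarrow> norm (F x - H x) < e"
    "\<And>y. finite {x. F x = y}" "finite {x. F x = x}"
proof -
  have comp: "compact (unit_cube :: (real ^ 'n) set)" by (simp add: unit_cube_eq_cbox)
  define m :: "real ^ 'n" where "m = (\<chi> i. 1 / 2)"
  have "bounded ((\<lambda>x. m - x) ` unit_cube)"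
    using comp by (intro compact_imp_bounded compact_continuous_image continuous_intros)
  then obtain M where M: "M > 0" "\<And>x. x \<in> unit_cube \<Longrightarrow> norm (m - x) \<le> M"
    by (auto simp: bounded_pos)
  define t where "t = min (1 / 2) (e / (2 * M))"
  have t: "0 < t" "t \<le> 1 / 2" "t * M \<le> e / 2"
  proof -
    show "0 < t" "t \<le> 1 / 2" using M \<open>e > 0\<close> by (auto simp: t_def)
    have "t * M \<le> e / (2 * M) * M" using M by (intro mult_right_mono) (auto simp: t_def)
    then show "t * M \<le> e / 2" using M by simp
  qed
  define G where "G = (\<lambda>x. (1 - t) *\<^sub>R H x + t *\<^sub>R m)"
  have "continuous_on unit_cube G"
    unfolding G_def by (intro continuous_intros H)
  then obtain F where F: "continuous_on UNIV F"
    "\<And>x. x \<in> unit_cube \<Longrightarrow> norm (F x - G x) < min (t / 2) (e / 2)"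
    "\<And>y. finite {x. F x = y}" "finite {x. F x = x}"
    using approximation_with_finite_fibres[OF comp, of G "min (t / 2) (e / 2)"] t \<open>e > 0\<close>
    by auto
  show thesis
  proof
    show "F \<in> unit_cube \<rightarrow> unit_cube"
    proof
      fix x :: "real ^ 'n" assume x: "x \<in> unit_cube"
      have "0 \<le> F x $ i \<and> F x $ i \<le> 1" for i
      proof -
        have "\<bar>F x $ i - G x $ i\<bar> < t / 2"
          using component_le_norm_cart[of "F x - G x" i] F(2)[OF x] by simp
        moreover have Hi: "0 \<le> H x $ i" "H x $ i \<le> 1"
          using H(2) x by (auto simp: unit_cube_def Pi_iff)
        have "0 \<le> (1 - t) * H x $ i" "(1 - t) * H x $ i \<le> 1 - t"
          using Hi t mult_left_mono[OF Hi(2), of "1 - t"] by auto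
        moreover have "G x $ i = (1 - t) * H x $ i + t / 2" by (simp add: G_def m_def)
        ultimately show ?thesis by linarith
      qed
      then show "F x \<in> unit_cube" by (simp add: unit_cube_def)
    qed
    show "norm (F x - H x) < e" if "x \<in> unit_cube" for x
    proof -
      have "G x - H x = t *\<^sub>R (m - H x)" by (simp add: G_def algebra_simps)
      then have "norm (G x - H x) = t * norm (m - H x)" using t by simp
      moreover have "t * norm (m - H x) \<le> t * M"
        using M(2)[of "H x"] H(2) that t by (intro mult_left_mono) auto
      ultimately have "norm (G x - H x) \<le> e / 2" using t by linarith
      moreover have "norm (F x - G x) < e / 2" using F(2)[OF that] by simp
      ultimately show ?thesis
        using norm_triangle_ineq[of "F x - G x" "G x - H x"] by simp
    qed
  qed (use F in auto)
qed

lemma finite_fibre_approximation: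
  fixes H :: "real ^ 'n \<Rightarrow> real ^ 'n"
  assumes S: "S = unit_cube \<or> S = UNIV" and H: "continuous_on S H" "H \<in> S \<rightarrow> S"
    and K: "compact K" "K \<subseteq> S" and "e > 0"
  obtains F where "continuous_on UNIV F" "F \<in> S \<rightarrow> S"
    "\<And>x. x \<in> K \<Longrightarrow> norm (F x - H x) < e"
    "\<And>y. finite {x. F x = y}" "finite {x. F x = x}"
  using S
proof
  assume "S = UNIV"
  have "continuous_on K H" using H(1) K(2) continuous_on_subset by blast
  from approximation_with_finite_fibres[OF K(1) this \<open>e > 0\<close>] obtain F
    where "continuous_on UNIV F" "\<And>x. x \<in> K \<Longrightarrow> norm (F x - H x) < e"
      "\<And>y. finite {x. F x = y}" "finite {x. F x = x}" by blast
  then show thesis using \<open>S = UNIV\<close> by (intro that[of F]) auto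
next
  assume S: "S = unit_cube"
  from finite_fibre_approximation_unit_cube[OF H[unfolded S] \<open>e > 0\<close>] obtain F
    where "continuous_on UNIV F" "F \<in> unit_cube \<rightarrow> unit_cube"
      "\<And>x. x \<in> unit_cube \<Longrightarrow> norm (F x - H x) < e"
      "\<And>y. finite {x. F x = y}" "finite {x. F x = x}" by blast
  then show thesis using S K(2) by (intro that[of F]) auto
qed

text \<open>Having a square root is invariant under conjugation by a bijection, so a root on
  \<open>X\<close> would pull back to one for \<open>f\<close> on \<open>S\<close>.\<close>

lemma rootless_in_neighbourhood:
  fixes X :: "'a topology" and S :: "(real ^ 'n) set"
  assumes S: "S = unit_cube \<or> S = UNIV" and hom: "X homeomorphic_space top_of_set S"
    and h: "h \<in> self_maps X" and U: "openin (compact_open_topology X) U" "h \<in> U"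
  shows "\<exists>f\<in>self_maps X. f \<in> U \<and> \<not> has_iterative_square_root X f"
proof -
  obtain \<phi> \<psi> where hm: "homeomorphic_maps (top_of_set S) X \<phi> \<psi>"
    using hom unfolding homeomorphic_space_def by (meson homeomorphic_maps_sym)
  then have cont: "continuous_map (top_of_set S) X \<phi>" "continuous_map X (top_of_set S) \<psi>"
    and inv: "\<And>x. x \<in> S \<Longrightarrow> \<psi> (\<phi> x) = x"
    by (auto simp: homeomorphic_maps_def)
  have \<psi>S: "\<psi> x \<in> S" if "x \<in> topspace X" for x
    using continuous_map_image_subset_topspace[OF cont(2)] that by auto
  have \<phi>X: "\<phi> x \<in> topspace X" if "x \<in> S" for x
    using continuous_map_image_subset_topspace[OF cont(1)] that by auto
  have S': "closed S" "convex S" "infinite S"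
    using S infinite_unit_cube by (auto simp: unit_cube_eq_cbox dest: finite_subset[OF subset_UNIV])
  obtain K e where K: "compact K" "K \<subseteq> S" and "e > 0"
    and inU: "\<And>f. continuous_on S f \<Longrightarrow> f \<in> S \<rightarrow> S \<Longrightarrow> \<forall>x\<in>K. dist (f x) (\<psi> (h (\<phi> x))) < e \<Longrightarrow>
      restrict (\<phi> \<circ> f \<circ> \<psi>) (topspace X) \<in> U"
    using compact_open_topology_neighbourhood[OF hm U] by blast
  define H where "H = \<psi> \<circ> h \<circ> \<phi>"
  have hmap: "continuous_map X X h" using h by (simp add: self_maps_def)
  have "continuous_map (top_of_set S) (top_of_set S) H"
    unfolding H_def by (rule continuous_map_compose[OF cont(1) continuous_map_compose[OF hmap cont(2)]])
  then have H: "continuous_on S H" "H \<in> S \<rightarrow> S" by auto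
  have "e / 2 > 0" using \<open>e > 0\<close> by simp
  obtain F where F: "continuous_on UNIV F" "F \<in> S \<rightarrow> S"
    "\<And>x. x \<in> K \<Longrightarrow> norm (F x - H x) < e / 2"
    "\<And>y. finite {x. F x = y}" "finite {x. F x = x}"
    using finite_fibre_approximation[OF S H K \<open>e / 2 > 0\<close>] by blast
  have contF: "continuous_on S F" using F(1) continuous_on_subset by blast
  have fib: "finite {x \<in> S. F x = y}" for y
    by (rule finite_subset[OF _ F(4)[of y]]) auto
  have fixp: "finite {x \<in> S. F x = x}"
    by (rule finite_subset[OF _ F(5)]) auto
  obtain f where f: "continuous_on S f" "f \<in> S \<rightarrow> S"
    and fF: "\<And>x. x \<in> K \<Longrightarrow> norm (f x - F x) < e / 2"
    and noroot: "\<not> (\<exists>g\<in>S \<rightarrow> S. \<forall>x\<in>S. g (g x) = f x)"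
    using rootless_approximation[OF S' contF F(2) fib fixp K \<open>e / 2 > 0\<close>] by blast
  define f' where "f' = restrict (\<phi> \<circ> f \<circ> \<psi>) (topspace X)"
  have "dist (f x) (\<psi> (h (\<phi> x))) < e" if "x \<in> K" for x
    using fF[OF that] F(3)[OF that] norm_triangle_ineq[of "f x - F x" "F x - H x"]
    by (simp add: H_def dist_norm)
  then have "f' \<in> U" unfolding f'_def using inU[OF f] by blast
  moreover have "U \<subseteq> self_maps X" using openin_subset[OF U(1)] by simp
  moreover have "\<not> has_iterative_square_root X f'"
  proof
    assume "has_iterative_square_root X f'"
    then obtain g where g: "g \<in> topspace X \<rightarrow> topspace X" "\<And>x. x \<in> topspace X \<Longrightarrow> g (g x) = f' x"
      unfolding has_iterative_square_root_def by blast
    have \<phi>\<psi>: "\<phi> (\<psi> y) = y" if "y \<in> topspace X" for y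
      using hm that by (simp add: homeomorphic_maps_def)
    have "(\<psi> \<circ> g \<circ> \<phi>) \<in> S \<rightarrow> S"
      by (auto intro!: \<psi>S \<phi>X funcset_mem[OF g(1)])
    moreover have "(\<psi> \<circ> g \<circ> \<phi>) ((\<psi> \<circ> g \<circ> \<phi>) x) = f x" if "x \<in> S" for x
    proof -
      have "g (\<phi> x) \<in> topspace X" using g(1) \<phi>X[OF that] by auto
      moreover have "f x \<in> S" using f(2) that by auto
      ultimately show ?thesis
        using g(2)[OF \<phi>X[OF that]] \<phi>X[OF that] inv that by (simp add: \<phi>\<psi> f'_def)
    qed
    ultimately show False using noroot by blast
  qed
  ultimately show ?thesis by blast
qed

lemma has_iterative_square_root_if_iterated_square:
  "f \<in> iterated_squares X \<Longrightarrow> has_iterative_square_root X f"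
proof -
  assume "f \<in> iterated_squares X"
  then obtain g where f: "f = compose (topspace X) g g" and g: "continuous_map X X g"
    by (auto simp: iterated_squares_def self_maps_def)
  then have "g \<in> topspace X \<rightarrow> topspace X"
    using continuous_map_image_subset_topspace[OF g] by blast
  then show ?thesis
    unfolding has_iterative_square_root_def by (intro bexI[of _ g]) (auto simp: f compose_def)
qed

section \<open>Approximation by squares\<close>

text \<open>Write \<open>D\<close> for the cap \<open>1 - d \<le> x \<bullet> a\<close> of the ball and \<open>L\<close> for its complementary part.
  The similarity \<open>E\<close> maps the ball into the interior of \<open>D\<close> and reverses the direction \<open>a\<close>,
  so that \<open>E ` D\<close> is exactly the part of \<open>E ` S\<close> in the convex set \<open>T\<close> given by
  \<open>x \<bullet> a \<le> s\<close>, and \<open>T\<close> contains \<open>L\<close>. Put \<open>g = E\<close> on \<open>L\<close> and \<open>g (E x) = f x\<close>, then extend \<open>g\<close>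
  over \<open>D \<inter> T\<close> with values in \<open>T\<close> near \<open>a\<close>, and over the rest of \<open>D\<close> with values in \<open>T\<close>.
  Since \<open>g\<close> maps \<open>T\<close> close to \<open>a\<close>, \<open>g (g x)\<close> is close to \<open>a\<close> on \<open>D\<close>, as is \<open>H x\<close>.\<close>

lemma square_approximation_cball:
  fixes H :: "'a::euclidean_space \<Rightarrow> 'a"
  assumes H: "continuous_on (cball 0 1) H" "H \<in> cball 0 1 \<rightarrow> cball 0 1"
    and a: "norm a = 1" "H a = a" and "e > 0"
  obtains g where "continuous_on (cball 0 1) g" "g \<in> cball 0 1 \<rightarrow> cball 0 1"
    "\<And>x. x \<in> cball 0 1 \<Longrightarrow> norm (g (g x) - H x) < e"
proof -
  define S where "S = cball (0::'a) 1"
  have S: "compact S" "closed S" "convex S" "a \<in> S"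
    using a by (auto simp: S_def)
  have contH: "continuous_on S H" and HS: "\<And>x. x \<in> S \<Longrightarrow> H x \<in> S"
    using H by (auto simp: S_def)
  have aa: "a \<bullet> a = 1" using a by (simp add: norm_eq_1)
  have inner_le: "x \<bullet> a \<le> norm x" for x
    using norm_cauchy_schwarz[of x a] a by simp
  obtain \<eta> where \<eta>: "\<eta> > 0" "\<And>x. x \<in> S \<Longrightarrow> dist x a < \<eta> \<Longrightarrow> dist (H x) a < e / 6"
    using contH \<open>e > 0\<close> S(4) a(2) unfolding continuous_on_iff
    by (metis zero_less_divide_iff zero_less_numeral)
  define \<rho> where "\<rho> = min \<eta> (e / 3)"
  define t where "t = min (1/2) (e / 6)"
  \<comment> \<open>On the cap the squared distance to \<open>a\<close> is at most
    \<open>2 * d\<close>, so the cap lies within \<open>\<rho>\<close> of \<open>a\<close>. The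
    bound by \<open>t\<close> keeps the values of \<open>f\<close> at height at most
    \<open>1 - d\<close>.\<close>
  define d where "d = min t (\<rho>\<^sup>2 / 4)"
  have \<rho>: "\<rho> > 0" "\<rho> \<le> \<eta>" "\<rho> \<le> e / 3" using \<eta> \<open>e > 0\<close> by (auto simp: \<rho>_def)
  have t: "0 < t" "t \<le> 1/2" "t \<le> e / 6" using \<open>e > 0\<close> by (auto simp: t_def)
  have d: "0 < d" "d \<le> t" "d \<le> 1/2" "2 * d < \<rho>\<^sup>2" using t \<rho> by (auto simp: d_def min_def)
  have near: "dist x a < \<rho>" if "x \<in> S" "1 - d \<le> x \<bullet> a" for x
  proof -
    have "(norm (x - a))\<^sup>2 = (norm x)\<^sup>2 - 2 * (x \<bullet> a) + 1"
      using aa by (simp add: power2_norm_eq_inner inner_diff_left inner_diff_right inner_commute)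
    moreover have "(norm x)\<^sup>2 \<le> 1" using that by (simp add: S_def power_le_one)
    ultimately have "(norm (x - a))\<^sup>2 < \<rho>\<^sup>2" using that d by linarith
    then show ?thesis using \<rho> by (simp add: dist_norm power2_less_imp_less)
  qed
  define f where "f = (\<lambda>x. (1 - t) *\<^sub>R H x)"
  have contf: "continuous_on S f" unfolding f_def by (intro continuous_intros contH)
  have f_norm: "norm (f x) \<le> 1 - t" if "x \<in> S" for x
    using HS[OF that] t mult_left_mono[of "norm (H x)" 1 "1 - t"] by (simp add: f_def S_def)
  have f_inner: "f x \<bullet> a \<le> 1 - d" if "x \<in> S" for x
    using f_norm[OF that] inner_le[of "f x"] d by linarith
  have fS: "f x \<in> S" if "x \<in> S" for x using f_norm[OF that] t by (simp add: S_def)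
  have fH: "norm (f x - H x) \<le> t" if "x \<in> S" for x
  proof -
    have "f x - H x = - (t *\<^sub>R H x)" by (simp add: f_def algebra_simps)
    then have "norm (f x - H x) = t * norm (H x)" using t by simp
    then show ?thesis using HS[OF that] t mult_left_mono[of "norm (H x)" 1 t] by (simp add: S_def)
  qed
  \<comment> \<open>With centre \<open>c *\<^sub>R a\<close> and ratio \<open>b\<close>, the image
    of \<open>E\<close> has norms at most \<open>1 - d / 4\<close> and heights at least
    \<open>1 - 3 * d / 4\<close>.\<close>
  define c where "c = 1 - d / 2"
  define b where "b = d / 4"
  \<comment> \<open>The height to which \<open>E\<close> takes the plane bounding the cap.\<close>
  define s where "s = c - b * (1 - d)"
  have b: "b > 0" using d by (simp add: b_def)
  have s: "1 - d < s" 
  proof -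
    have "s = 1 - d + d / 4 + d * d / 4" by (simp add: s_def c_def b_def field_simps)
    then show ?thesis using mult_pos_pos[OF d(1) d(1)] d(1) by linarith
  qed
  define E where "E = (\<lambda>x. c *\<^sub>R a - b *\<^sub>R x)"
  define E' where "E' = (\<lambda>y. (1 / b) *\<^sub>R (c *\<^sub>R a - y))"
  have contE: "continuous_on A E" and contE': "continuous_on A E'" for A
    unfolding E_def E'_def by (intro continuous_intros)+
  have E'E: "E' (E x) = x" for x using b by (simp add: E_def E'_def)
  have E_inner: "E x \<bullet> a = c - b * (x \<bullet> a)" for x by (simp add: E_def inner_diff_left aa)
  have ES: "E x \<in> S" and E_gt: "1 - d < E x \<bullet> a" if "x \<in> S" for x
  proof -
    have "norm (E x) \<le> c + b * norm x"
      using norm_triangle_ineq4[of "c *\<^sub>R a" "b *\<^sub>R x"] a b d by (simp add: E_def c_def)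
    moreover have bx: "b * norm x \<le> b" using that b by (simp add: S_def)
    ultimately have "norm (E x) \<le> c + b" by linarith
    then show "E x \<in> S" using d by (simp add: S_def c_def b_def)
    have "b * (x \<bullet> a) \<le> b * norm x" using b inner_le by simp
    then show "1 - d < E x \<bullet> a" using bx d(1) b_def unfolding E_inner c_def by linarith
  qed
  have E_le: "E x \<bullet> a \<le> s \<longleftrightarrow> 1 - d \<le> x \<bullet> a" for x
    using b by (simp add: E_inner s_def)
  define T where "T = {x \<in> S. x \<bullet> a \<le> s}"
  define D where "D = {x \<in> S. 1 - d \<le> x \<bullet> a}"
  define L where "L = {x \<in> S. x \<bullet> a \<le> 1 - d}"
  have "T = S \<inter> {x. a \<bullet> x \<le> s}" "L = S \<inter> {x. a \<bullet> x \<le> 1 - d}" "D = S \<inter> {x. a \<bullet> x \<ge> 1 - d}"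
    by (auto simp: T_def D_def L_def inner_commute)
  then have T: "convex T" and cl: "compact D" "compact L" "closed T"
    using S by (auto intro: convex_Int convex_halfspace_le compact_Int_closed closed_Int
        closed_halfspace_le closed_halfspace_ge)
  have fT: "f x \<in> T" if "x \<in> S" for x
    using f_inner[OF that] fS[OF that] s by (simp add: T_def)
  have cont_fE': "continuous_on (E ` A) (\<lambda>y. f (E' y))" if "A \<subseteq> S" for A
    using that by (intro continuous_on_compose2[OF contf contE']) (auto simp: E'E)
  have closed_img: "closed (E ` A)" if "compact A" for A
    using that by (intro compact_imp_closed compact_continuous_image contE)
  define N where "N = cball a (e / 3) \<inter> T"
  have N: "convex N" using T by (simp add: N_def convex_Int)
  have EN: "E x \<in> N" if "x \<in> D" for x
    using that near[OF ES less_imp_le[OF E_gt], of x] ES[of x] E_le[of x] \<rho>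
    by (simp add: N_def T_def D_def dist_commute)
  have fN: "f x \<in> N" if "x \<in> D" for x
  proof -
    have x: "x \<in> S" "dist (H x) a < e / 6"
      using that near[of x] \<eta>(2)[of x] \<rho> by (auto simp: D_def)
    have "dist (f x) a \<le> dist (f x) (H x) + dist (H x) a" by (rule dist_triangle)
    then have "dist (f x) a \<le> e / 3" using x fH[OF x(1)] t by (simp add: dist_norm)
    then show ?thesis using fT[OF x(1)] by (simp add: N_def dist_commute)
  qed
  \<comment> \<open>The interface of cap and complement, where the extension has to agree with
    \<open>E\<close>.\<close>
  define B where "B = {x \<in> S. x \<bullet> a = 1 - d}"
  have BD: "B = D \<inter> L" by (auto simp: B_def D_def L_def)
  have clB: "closed B" using cl by (simp add: BD compact_imp_closed closed_Int)
  define u0 where "u0 = (\<lambda>x. if x \<bullet> a \<le> 1 - d then E x else f (E' x))"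
  have u0E: "u0 (E x) = f x" if "x \<in> S" for x
    using E_gt[OF that] by (simp add: u0_def E'E)
  have "continuous_on (B \<union> E ` D) u0"
    unfolding u0_def
  proof (rule continuous_on_cases[OF clB closed_img[OF cl(1)] contE cont_fE'])
    show "D \<subseteq> S" by (auto simp: D_def)
    show "\<forall>x. x \<in> B \<and> \<not> x \<bullet> a \<le> 1 - d \<or> x \<in> E ` D \<and> x \<bullet> a \<le> 1 - d \<longrightarrow> E x = f (E' x)"
      using E_gt by (fastforce simp: B_def D_def)
  qed
  moreover have "u0 ` (B \<union> E ` D) \<subseteq> N"
  proof clarify
    fix x assume "x \<in> B \<union> E ` D"
    then show "u0 x \<in> N"
    proof
      assume "x \<in> B"
      then show ?thesis using EN[of x] by (simp add: u0_def BD L_def)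
    next
      assume "x \<in> E ` D"
      then show ?thesis using fN u0E by (auto simp: D_def)
    qed
  qed
  moreover have "closedin (top_of_set D) (B \<union> E ` D)"
  proof (rule closed_subset)
    show "B \<union> E ` D \<subseteq> D" using ES E_gt by (force simp: BD D_def)
    show "closed (B \<union> E ` D)" using clB closed_img cl by auto
  qed
  moreover have "N \<noteq> {}" using EN[of a] S(4) aa d by (auto simp: D_def)
  ultimately obtain u where contu: "continuous_on D u" and uN: "u ` D \<subseteq> N"
    and u: "\<And>x. x \<in> B \<union> E ` D \<Longrightarrow> u x = u0 x"
    using Dugundji[OF N] by metis
  have "N \<subseteq> T" by (auto simp: N_def)
  \<comment> \<open>The pieces meet only in images under \<open>E\<close> of points of
    \<open>B\<close>; there \<open>u\<close> already equals \<open>f\<close> composed with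
    \<open>E'\<close>.\<close>
  define v0 where "v0 = (\<lambda>x. if x \<bullet> a \<le> s then u x else f (E' x))"
  have v0E: "v0 (E x) = f x" if "x \<in> S" for x
    using that u[of "E x"] u0E[OF that] E_le[of x] by (auto simp: v0_def E'E D_def)
  have "continuous_on (D \<inter> T \<union> E ` L) v0"
    unfolding v0_def
  proof (rule continuous_on_cases[OF _ closed_img[OF cl(2)] _ cont_fE'])
    show "closed (D \<inter> T)" using cl by (simp add: compact_imp_closed closed_Int)
    show "continuous_on (D \<inter> T) u" using contu continuous_on_subset by blast
    show "L \<subseteq> S" by (auto simp: L_def)
    have "u (E x) = f (E' (E x))" if "x \<in> L" "E x \<bullet> a \<le> s" for x
      using that u[of "E x"] u0E[of x] E_le[of x] by (auto simp: E'E D_def L_def)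
    then show "\<forall>x. x \<in> D \<inter> T \<and> \<not> x \<bullet> a \<le> s \<or> x \<in> E ` L \<and> x \<bullet> a \<le> s \<longrightarrow> u x = f (E' x)"
      by (auto simp: T_def)
  qed
  moreover have "v0 ` (D \<inter> T \<union> E ` L) \<subseteq> T"
  proof clarify
    fix x assume "x \<in> D \<inter> T \<union> E ` L"
    then show "v0 x \<in> T"
    proof
      assume "x \<in> D \<inter> T"
      then show ?thesis using uN \<open>N \<subseteq> T\<close> by (auto simp: v0_def T_def)
    next
      assume "x \<in> E ` L"
      then show ?thesis using fT v0E by (auto simp: L_def)
    qed
  qed
  moreover have "closedin (top_of_set D) (D \<inter> T \<union> E ` L)"
  proof (rule closed_subset)
    show "D \<inter> T \<union> E ` L \<subseteq> D" using ES E_gt by (force simp: L_def D_def)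
    show "closed (D \<inter> T \<union> E ` L)" using closed_img[OF cl(2)] compact_imp_closed[OF cl(1)] cl(3) by (intro closed_Un closed_Int)
  qed
  moreover have "T \<noteq> {}" using \<open>N \<noteq> {}\<close> \<open>N \<subseteq> T\<close> by blast
  ultimately obtain v where contv: "continuous_on D v" and vT: "v ` D \<subseteq> T"
    and v: "\<And>x. x \<in> D \<inter> T \<union> E ` L \<Longrightarrow> v x = v0 x"
    using Dugundji[OF T] by metis
  have vu: "v x = u x" if "x \<in> D" "x \<in> T" for x
    using v[of x] that by (simp add: v0_def T_def)
  define g where "g = (\<lambda>x. if x \<bullet> a \<le> 1 - d then E x else v x)"
  have gE: "g (E x) = f x" if "x \<in> S" for x
  proof -
    have "E x \<in> D \<inter> T \<union> E ` L"
      using that ES[OF that] E_gt[OF that] E_le[of x] by (auto simp: D_def T_def L_def)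
    then show ?thesis using v v0E[OF that] E_gt[OF that] by (simp add: g_def)
  qed
  have g_near: "dist (g x) a \<le> e / 3" if "x \<in> T" for x
  proof (cases "x \<bullet> a \<le> 1 - d")
    case True
    then show ?thesis using that near[OF ES less_imp_le[OF E_gt], of x] \<rho>
      by (simp add: g_def T_def)
  next
    case False
    then have "x \<in> D" using that by (simp add: D_def T_def)
    then have "u x \<in> N" using uN by blast
    then show ?thesis using False vu[OF \<open>x \<in> D\<close> that] by (simp add: g_def N_def dist_commute)
  qed
  \<comment> \<open>Together with \<open>g_near\<close> this controls points off \<open>L\<close>:
    their first image lies in \<open>T\<close>, hence the second is near \<open>a\<close>.\<close>
  have gT: "g x \<in> T" if "x \<in> S" "1 - d < x \<bullet> a" for x
    using that vT by (auto simp: g_def D_def)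
  show thesis
  proof
    show "continuous_on (cball 0 1) g"
      unfolding g_def S_def[symmetric]
    proof (rule continuous_on_cases_le[OF contE])
      show "continuous_on {x \<in> S. 1 - d \<le> x \<bullet> a} v" using contv by (simp add: D_def)
      show "continuous_on S (\<lambda>x. x \<bullet> a)" by (intro continuous_intros)
      show "E x = v x" if "x \<in> S" "x \<bullet> a = 1 - d" for x
        using that s vu[of x] u[of x] by (auto simp: D_def T_def B_def u0_def)
    qed
    have "g x \<in> S" if "x \<in> S" for x
      using ES[OF that] gT[OF that] by (cases "x \<bullet> a \<le> 1 - d") (auto simp: g_def T_def)
    then show "g \<in> cball 0 1 \<rightarrow> cball 0 1" by (auto simp: S_def)
    show "norm (g (g x) - H x) < e" if "x \<in> cball 0 1" for x
    proof (cases "x \<bullet> a \<le> 1 - d")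
      case True
      have "x \<in> S" using that by (simp add: S_def)
      then have "g (g x) = f x" using True gE by (simp add: g_def)
      then show ?thesis using fH[OF \<open>x \<in> S\<close>] t \<open>e > 0\<close> by simp
    next
      case False
      have "x \<in> S" using that by (simp add: S_def)
      then have "dist (g (g x)) a \<le> e / 3" using False by (intro g_near gT) auto
      moreover have "dist (H x) a < e / 6"
        using near[of x] \<eta>(2)[of x] \<rho> \<open>x \<in> S\<close> False by simp
      moreover have "dist (g (g x)) (H x) \<le> dist (g (g x)) a + dist (H x) a"
        by (rule dist_triangle2)
      ultimately show ?thesis using \<open>e > 0\<close> by (simp add: dist_norm)
    qed
  qed
qed

text \<open>Cube and ball are homeomorphic as compact convex sets of equal dimension. The ball
  result is transported along this homeomorphism followed by \<open>\<phi>\<close>.\<close>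

lemma square_in_neighbourhood:
  fixes X :: "'a topology" and \<phi> :: "real ^ 'n \<Rightarrow> 'a"
  assumes hom: "homeomorphic_map (top_of_set unit_cube) X \<phi>" and h: "h \<in> self_maps X"
    and x0: "x0 \<in> \<phi> ` frontier unit_cube" "h x0 = x0"
    and U: "openin (compact_open_topology X) U" "h \<in> U"
  shows "\<exists>g\<in>self_maps X. compose (topspace X) g g \<in> U"
proof -
  let ?C = "unit_cube :: (real ^ 'n) set" and ?B = "cball (0 :: real ^ 'n) 1"
  obtain z where z: "z \<in> frontier ?C" "x0 = \<phi> z" using x0 by blast
  have "closed ?C" by (simp add: unit_cube_eq_cbox closed_cbox)
  then have "z \<in> ?C" using z frontier_subset_closed by blast
  have "box (0 :: real ^ 'n) 1 \<noteq> {}"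
    by (simp add: interval_ne_empty_cart)
  then have "aff_dim ?C = aff_dim ?B"
    by (simp add: unit_cube_eq_cbox interior_cbox aff_dim_nonempty_interior)
  then have "?B homeomorphic ?C"
    by (intro homeomorphic_convex_compact_sets) (auto simp: unit_cube_eq_cbox)
  then obtain \<theta> \<theta>' where \<theta>: "homeomorphism ?B ?C \<theta> \<theta>'"
    unfolding homeomorphic_def by blast
  then have "homeomorphic_maps (top_of_set ?B) (top_of_set ?C) \<theta> \<theta>'"
    by (auto simp: homeomorphism_def homeomorphic_maps_def simp del: mem_cball mem_cball_0)
  moreover obtain \<phi>' where "homeomorphic_maps (top_of_set ?C) X \<phi> \<phi>'"
    using hom homeomorphic_map_maps by blast
  ultimately have "homeomorphic_maps (top_of_set ?B) X (\<phi> \<circ> \<theta>) (\<theta>' \<circ> \<phi>')"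
    by (intro homeomorphic_maps_compose conjI)
  then obtain \<Phi> \<Psi> where hm: "homeomorphic_maps (top_of_set ?B) X \<Phi> \<Psi>" and \<Phi>: "\<Phi> = \<phi> \<circ> \<theta>"
    by blast
  define a where "a = \<theta>' z"
  have a: "a \<in> ?B" "\<theta> a = z"
    using \<theta> \<open>z \<in> ?C\<close> by (auto simp: a_def homeomorphism_def)
  \<comment> \<open>By invariance of domain, an interior point of the ball would be sent to an
    interior point of the cube.\<close>
  have "norm a = 1"
  proof (rule ccontr)
    assume "norm a \<noteq> 1"
    then have "a \<in> ball 0 1" using a by simp
    have "continuous_on ?B \<theta>" "inj_on \<theta> ?B"
      using \<theta> by (auto simp: homeomorphism_def intro: inj_on_inverseI)
    then have "open (\<theta> ` ball 0 1)"
      by (intro invariance_of_domain_ball) auto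
    moreover have "\<theta> ` ball 0 1 \<subseteq> ?C"
      using \<theta> ball_subset_cball by (auto simp: homeomorphism_def)
    ultimately have "z \<in> interior ?C"
      using \<open>a \<in> ball 0 1\<close> a by (metis imageI interior_maximal subsetD)
    then show False using z by (simp add: frontier_def)
  qed
  have cont: "continuous_map (top_of_set ?B) X \<Phi>" "continuous_map X (top_of_set ?B) \<Psi>"
    and inv: "\<And>x. x \<in> ?B \<Longrightarrow> \<Psi> (\<Phi> x) = x"
    using hm by (auto simp: homeomorphic_maps_def)
  have \<Psi>B: "\<Psi> x \<in> ?B" if "x \<in> topspace X" for x
    using continuous_map_image_subset_topspace[OF cont(2)] that by auto
  obtain K e where K: "K \<subseteq> ?B" and "e > 0"
    and inU: "\<And>f. continuous_on ?B f \<Longrightarrow> f \<in> ?B \<rightarrow> ?B \<Longrightarrow> \<forall>x\<in>K. dist (f x) (\<Psi> (h (\<Phi> x))) < e \<Longrightarrow>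
      restrict (\<Phi> \<circ> f \<circ> \<Psi>) (topspace X) \<in> U"
    using compact_open_topology_neighbourhood[OF hm U] by blast
  define H where "H = \<Psi> \<circ> h \<circ> \<Phi>"
  have hmap: "continuous_map X X h" using h by (simp add: self_maps_def)
  have "continuous_map (top_of_set ?B) (top_of_set ?B) H"
    unfolding H_def by (rule continuous_map_compose[OF cont(1) continuous_map_compose[OF hmap cont(2)]])
  then have H: "continuous_on ?B H" "H \<in> ?B \<rightarrow> ?B" by auto
  have "H a = a" using x0(2) z(2) a inv[OF a(1)] by (simp add: H_def \<Phi>)
  obtain g where g: "continuous_on ?B g" "g \<in> ?B \<rightarrow> ?B"
    and gH: "\<And>x. x \<in> ?B \<Longrightarrow> norm (g (g x) - H x) < e"
    using square_approximation_cball[OF H \<open>norm a = 1\<close> \<open>H a = a\<close> \<open>e > 0\<close>] by blast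
  define G where "G = restrict (\<Phi> \<circ> g \<circ> \<Psi>) (topspace X)"
  have gmap: "continuous_map (top_of_set ?B) (top_of_set ?B) g" using g by simp
  have contG: "continuous_map X X (\<Phi> \<circ> g \<circ> \<Psi>)"
    by (rule continuous_map_compose[OF cont(2) continuous_map_compose[OF gmap cont(1)]])
  then have "G \<in> self_maps X"
    unfolding G_def by (auto simp: self_maps_def intro: continuous_map_eq)
  moreover have "restrict (\<Phi> \<circ> (g \<circ> g) \<circ> \<Psi>) (topspace X) \<in> U"
  proof (rule inU)
    have "continuous_map (top_of_set ?B) (top_of_set ?B) (g \<circ> g)"
      by (rule continuous_map_compose[OF gmap gmap])
    then show "continuous_on ?B (g \<circ> g)" "g \<circ> g \<in> ?B \<rightarrow> ?B" by auto
    show "\<forall>x\<in>K. dist ((g \<circ> g) x) (\<Psi> (h (\<Phi> x))) < e"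
      using gH K by (auto simp: H_def dist_norm)
  qed
  \<comment> \<open>The inner \<open>\<Psi>\<close> and \<open>\<Phi>\<close> cancel on
    \<open>topspace X\<close>; elsewhere both sides are \<open>undefined\<close>.\<close>
  moreover have "compose (topspace X) G G = restrict (\<Phi> \<circ> (g \<circ> g) \<circ> \<Psi>) (topspace X)"
  proof
    fix x
    show "compose (topspace X) G G x = restrict (\<Phi> \<circ> (g \<circ> g) \<circ> \<Psi>) (topspace X) x"
    proof (cases "x \<in> topspace X")
      case True
      then have "\<Phi> (g (\<Psi> x)) \<in> topspace X"
        using continuous_map_image_subset_topspace[OF contG] by auto
      moreover have "g (\<Psi> x) \<in> ?B" using \<Psi>B[OF True] g(2) by blast
      ultimately show ?thesis using True inv by (simp add: compose_def G_def)
    qed (simp add: compose_def)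
  qed
  ultimately show ?thesis by metis
qed

theorem mainTheorem6:
  fixes X :: "'a topology"
  shows
    "(X homeomorphic_space top_of_set (unit_cube :: (real ^ 'n) set) \<or>
      X homeomorphic_space (euclidean :: (real ^ 'n) topology) \<longrightarrow>
        (\<forall>h \<in> self_maps X. \<forall>U. openin (compact_open_topology X) U \<and> h \<in> U \<longrightarrow>
          (\<exists>f \<in> self_maps X. f \<in> U \<and> \<not> has_iterative_square_root X f)) \<and>
        \<not> (\<exists>U. openin (compact_open_topology X) U \<and> U \<noteq> {} \<and> U \<subseteq> iterated_squares X))
     \<and>
     (\<forall>(\<phi> :: real ^ 'n \<Rightarrow> 'a) h x0.
        homeomorphic_map (top_of_set unit_cube) X \<phi> \<and> h \<in> self_maps X \<and>
        x0 \<in> \<phi> ` frontier unit_cube \<and> h x0 = x0 \<longrightarrow>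
          (\<forall>U. openin (compact_open_topology X) U \<and> h \<in> U \<longrightarrow>
            (\<exists>g \<in> self_maps X. compose (topspace X) g g \<in> U)) \<and>
          h \<in> (compact_open_topology X) closure_of (iterated_squares X))"
proof (intro conjI impI allI ballI; (elim conjE)?)
  assume X: "X homeomorphic_space top_of_set (unit_cube :: (real ^ 'n) set) \<or>
    X homeomorphic_space (euclidean :: (real ^ 'n) topology)"
  have rootless: "\<exists>f\<in>self_maps X. f \<in> U \<and> \<not> has_iterative_square_root X f"
    if "openin (compact_open_topology X) U" "h \<in> U" for h U
  proof -
    have "h \<in> self_maps X" using openin_subset[OF that(1)] that(2) by auto
    then show ?thesis
      using X that rootless_in_neighbourhood[of "unit_cube :: (real ^ 'n) set"]
        rootless_in_neighbourhood[of "UNIV :: (real ^ 'n) set"] by auto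
  qed
  show "\<exists>f\<in>self_maps X. f \<in> U \<and> \<not> has_iterative_square_root X f"
    if "openin (compact_open_topology X) U" "h \<in> U" for h U
    using rootless that by blast
  show "\<not> (\<exists>U. openin (compact_open_topology X) U \<and> U \<noteq> {} \<and> U \<subseteq> iterated_squares X)"
    using rootless has_iterative_square_root_if_iterated_square by (metis all_not_in_conv subsetD)
next
  fix \<phi> :: "real ^ 'n \<Rightarrow> 'a" and h x0
  assume *: "homeomorphic_map (top_of_set unit_cube) X \<phi>" "h \<in> self_maps X"
    "x0 \<in> \<phi> ` frontier unit_cube" "h x0 = x0"
  show "\<exists>g\<in>self_maps X. compose (topspace X) g g \<in> U"
    if "openin (compact_open_topology X) U" "h \<in> U" for U
    using square_in_neighbourhood[OF * that] .
  then show "h \<in> compact_open_topology X closure_of iterated_squares X"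
    using *(2) by (auto simp: in_closure_of iterated_squares_def)
qed

end
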